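(* Let $G$ be a graph, and let $I$ and $O$ be disjoint vertex sets such that $I$ is nonempty and both $G[I \cup O]$ and $G - (I \cup O)$ are edgeless. Then every minimal $(I,O)$-extension $S$ satisfies $|S| \leq |I \cup O|$.
   Context: All graphs are finite and simple. A vertex set $X$ is a connected dominating set of $G$ if every vertex not in $X$ has a neighbor in $X$ and $G[X]$ is connected. For disjoint vertex sets $I$ and $O$, an $(I,O)$-extension is a vertex set $S$ disjoint from $I \cup O$ such that $I \cup S$ is a connected dominating set of $G$; it is minimal if no proper subset of it is also an $(I,O)$-extension. *)

theory Defs
  imports "Graph_Theory.Digraph_Component"
begin

text \<open>
  A finite simple graph is a \<^const>\<open>graph\<close>: a finite, symmetric, loop-free digraph without
  parallel arcs. Note that \<^const>\<open>connected\<close> is false for the graph without vertices, so a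
  connected dominating set is nonempty here.
\<close>

definition connected_dominating_set :: "('a, 'b) pre_digraph \<Rightarrow> 'a set \<Rightarrow> bool" where
  "connected_dominating_set G X \<longleftrightarrow>
     X \<subseteq> verts G \<and>
     (\<forall>v \<in> verts G - X. \<exists>x \<in> X. v \<rightarrow>\<^bsub>G\<^esub> x) \<and>
     connected (G \<restriction> X)"

definition IO_extension ::
  "('a, 'b) pre_digraph \<Rightarrow> 'a set \<Rightarrow> 'a set \<Rightarrow> 'a set \<Rightarrow> bool" where
  "IO_extension G I O' S \<longleftrightarrow>
     S \<subseteq> verts G \<and> S \<inter> (I \<union> O') = {} \<and> connected_dominating_set G (I \<union> S)"

definition minimal_IO_extension ::
  "('a, 'b) pre_digraph \<Rightarrow> 'a set \<Rightarrow> 'a set \<Rightarrow> 'a set \<Rightarrow> bool" where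
  "minimal_IO_extension G I O' S \<longleftrightarrow>
     IO_extension G I O' S \<and> \<not> (\<exists>T. T \<subset> S \<and> IO_extension G I O' T)"

end

theory Submission
  imports Defs
begin

text \<open>
  In the bipartite graph spanned by \<open>I\<close> and \<open>S\<close>, a connected set can be grown so that each new
  vertex of \<open>I\<close> costs at most one vertex of \<open>S\<close>; hence some \<open>T \<subseteq> S\<close> with at most
  \<open>card I - 1\<close> elements already makes \<open>I \<union> T\<close> connected. Vertices outside \<open>I \<union> O'\<close> are
  dominated by \<open>I\<close>, so adding to \<open>T\<close> one neighbour for each vertex of \<open>O'\<close> gives an extension,
  which must be all of \<open>S\<close> by minimality.
\<close>

text \<open>A set that no arc leaves contains everything reachable from it, and the set of vertices
  reachable from a fixed one is such a set. Symmetry of the arcs makes connectedness the same as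
  strong connectedness, so one direction of crossing is enough.\<close>

lemma (in sym_digraph) connected_iff_cut:
  "connected G \<longleftrightarrow> verts G \<noteq> {} \<and>
     (\<forall>C. C \<noteq> {} \<and> C \<subset> verts G \<longrightarrow> (\<exists>u\<in>C. \<exists>v\<in>verts G - C. u \<rightarrow>\<^bsub>G\<^esub> v))"
proof
  assume "connected G"
  then have sc: "strongly_connected G"
    using sym_arcs symmetric_connected_imp_strongly_connected by blast
  have "\<exists>u\<in>C. \<exists>v\<in>verts G - C. u \<rightarrow>\<^bsub>G\<^esub> v" if C: "C \<noteq> {}" "C \<subset> verts G" for C
  proof (rule ccontr)
    assume no: "\<not> ?thesis"
    from C obtain a b where ab: "a \<in> C" "b \<in> verts G" "b \<notin> C" by blast
    then have "a \<rightarrow>\<^sup>* b" using sc C unfolding strongly_connected_def by blast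
    then have "b \<in> C"
      by (induction rule: reachable_induct) (use no ab adj_in_verts in blast)+
    with ab show False by simp
  qed
  with sc show "verts G \<noteq> {} \<and>
     (\<forall>C. C \<noteq> {} \<and> C \<subset> verts G \<longrightarrow> (\<exists>u\<in>C. \<exists>v\<in>verts G - C. u \<rightarrow>\<^bsub>G\<^esub> v))"
    unfolding strongly_connected_def by blast
next
  assume cut: "verts G \<noteq> {} \<and>
     (\<forall>C. C \<noteq> {} \<and> C \<subset> verts G \<longrightarrow> (\<exists>u\<in>C. \<exists>v\<in>verts G - C. u \<rightarrow>\<^bsub>G\<^esub> v))"
  have "a \<rightarrow>\<^sup>* b" if ab: "a \<in> verts G" "b \<in> verts G" for a b
  proof (rule ccontr)
    assume "\<not> a \<rightarrow>\<^sup>* b"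
    define C where "C = {x. a \<rightarrow>\<^sup>* x}"
    have "C \<noteq> {}" "C \<subset> verts G"
      using ab \<open>\<not> a \<rightarrow>\<^sup>* b\<close> reachable_in_verts unfolding C_def by blast+
    with cut obtain u v where "u \<in> C" "v \<in> verts G - C" "u \<rightarrow>\<^bsub>G\<^esub> v" by blast
    then show False unfolding C_def using reachable_adj_trans by blast
  qed
  with cut have "strongly_connected G" by blast
  then show "connected G"
    by (simp add: connected_def strongly_connected_def reachable_mk_symmetric_eq[OF sym_arcs])
qed

lemma dominates_induce_subgraph_iff:
  "u \<rightarrow>\<^bsub>G \<restriction> X\<^esub> v \<longleftrightarrow> u \<in> X \<and> v \<in> X \<and> u \<rightarrow>\<^bsub>G\<^esub> v"
  unfolding arcs_ends_conv by auto

text \<open>Expresses connectedness of an induced subgraph through arcs of \<open>G\<close> itself,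
  so that different vertex sets can be compared without paths.\<close>

lemma (in sym_digraph) connected_induce_subgraph_iff_cut:
  assumes "X \<subseteq> verts G"
  shows "connected (G \<restriction> X) \<longleftrightarrow> X \<noteq> {} \<and>
     (\<forall>C. C \<noteq> {} \<and> C \<subset> X \<longrightarrow> (\<exists>u\<in>C. \<exists>v\<in>X - C. u \<rightarrow>\<^bsub>G\<^esub> v))"
proof -
  interpret H: sym_digraph "G \<restriction> X"
    using assms by (intro induced_graph_imp_graph induced_induce)
  show ?thesis
    unfolding H.connected_iff_cut dominates_induce_subgraph_iff induce_subgraph_verts by blast
qed

lemma (in sym_digraph) dominates_sym: "u \<rightarrow>\<^bsub>G\<^esub> v \<Longrightarrow> v \<rightarrow>\<^bsub>G\<^esub> u"
  using sym_arcs by (rule arcs_ends_symmetric)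

text \<open>A cut of the larger set either restricts to a proper nonempty cut of \<open>X\<close>,
  or separates \<open>v\<close> from all of \<open>X\<close>; in the latter case the arc between
  \<open>x\<close> and \<open>v\<close> crosses it.\<close>

lemma (in sym_digraph) connected_induce_subgraph_insert:
  assumes "X \<subseteq> verts G" "connected (G \<restriction> X)" "x \<in> X" "x \<rightarrow>\<^bsub>G\<^esub> v"
  shows "connected (G \<restriction> insert v X)"
proof -
  have vG: "insert v X \<subseteq> verts G" using assms adj_in_verts by blast
  have cut: "\<exists>u\<in>C. \<exists>w\<in>X - C. u \<rightarrow>\<^bsub>G\<^esub> w" if "C \<noteq> {}" "C \<subset> X" for C
    using assms(2) that connected_induce_subgraph_iff_cut[OF assms(1)] by blast
  have "\<exists>u\<in>C. \<exists>w\<in>insert v X - C. u \<rightarrow>\<^bsub>G\<^esub> w" if C: "C \<noteq> {}" "C \<subset> insert v X" for C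
  proof -
    consider "C \<inter> X = {}" | "X \<subseteq> C" | "C \<inter> X \<noteq> {}" "C \<inter> X \<subset> X" by blast
    then show ?thesis
    proof cases
      case 1
      then have "C = {v}" "v \<notin> X" using C by auto
      then show ?thesis using assms(3) dominates_sym[OF assms(4)] by blast
    next
      case 2
      then have "v \<notin> C" using C by blast
      then show ?thesis using 2 assms by blast
    next
      case 3
      then show ?thesis using cut[of "C \<inter> X"] by blast
    qed
  qed
  then show ?thesis unfolding connected_induce_subgraph_iff_cut[OF vG] by blast
qed

text \<open>Each vertex of \<open>F\<close> attaches to \<open>X\<close> itself, so the vertices can
  be added one by one in any order.\<close>

lemma (in sym_digraph) connected_induce_subgraph_Un:
  assumes "finite F" "X \<subseteq> verts G" "connected (G \<restriction> X)" "\<And>v. v \<in> F \<Longrightarrow> \<exists>x\<in>X. x \<rightarrow>\<^bsub>G\<^esub> v"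
  shows "connected (G \<restriction> (X \<union> F))"
  using assms(1,4)
proof (induction F rule: finite_induct)
  case empty
  then show ?case using assms(3) by simp
next
  case (insert v F)
  have "X \<union> F \<subseteq> verts G" using assms(2) insert.prems adj_in_verts by blast
  moreover have "connected (G \<restriction> (X \<union> F))" using insert by blast
  moreover obtain x where "x \<in> X" "x \<rightarrow>\<^bsub>G\<^esub> v" using insert.prems by blast
  ultimately show ?case using connected_induce_subgraph_insert[of "X \<union> F" x v] by simp
qed

lemma (in sym_digraph) connected_induce_subgraph_singleton:
  assumes "v \<in> verts G"
  shows "connected (G \<restriction> {v})"
proof -
  have "{v} \<subseteq> verts G" using assms by simp
  from connected_induce_subgraph_iff_cut[OF this] show ?thesis by blast
qed

text \<open>The growth process is phrased extremally: among the nonempty parts of \<open>A\<close>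
  that fewer vertices of \<open>B\<close> than their own number suffice to connect, one of largest
  size is all of \<open>A\<close>.\<close>

lemma (in sym_digraph) bipartite_connector:
  assumes fin: "finite A" and ne: "A \<noteq> {}" and sub: "A \<union> B \<subseteq> verts G"
    and conn: "connected (G \<restriction> (A \<union> B))"
    and indA: "\<And>u v. u \<in> A \<Longrightarrow> v \<in> A \<Longrightarrow> \<not> u \<rightarrow>\<^bsub>G\<^esub> v"
    and indB: "\<And>u v. u \<in> B \<Longrightarrow> v \<in> B \<Longrightarrow> \<not> u \<rightarrow>\<^bsub>G\<^esub> v"
    and disj: "A \<inter> B = {}"
  obtains T where "T \<subseteq> B" "finite T" "card T < card A" "connected (G \<restriction> (A \<union> T))"
proof -
  define P where "P C \<longleftrightarrow> C \<subseteq> A \<and> C \<noteq> {} \<and>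
    (\<exists>T\<subseteq>B. finite T \<and> card T < card C \<and> connected (G \<restriction> (C \<union> T)))" for C
  from ne obtain a where a: "a \<in> A" by blast
  \<comment> \<open>A single vertex is connected with no help from \<open>B\<close>; this start is
    what makes the inequality in \<open>P\<close> strict.\<close>
  have "P {a}"
    unfolding P_def using a sub connected_induce_subgraph_singleton[of a]
    by (auto intro!: exI[of _ "{}"])
  moreover have bounded: "card C \<le> card A" if "P C" for C
    using that fin unfolding P_def by (auto intro: card_mono)
  ultimately have "\<exists>C. P C \<and> (\<forall>D. P D \<longrightarrow> card D \<le> card C)"
    by (intro ex_has_greatest_nat[of P "{a}" card "Suc (card A)"]) (auto simp: less_Suc_eq_le)
  then obtain C where C: "P C" and max: "\<And>D. P D \<Longrightarrow> card D \<le> card C" by blast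
  from C obtain T where T: "C \<subseteq> A" "C \<noteq> {}" "T \<subseteq> B" "finite T" "card T < card C"
      "connected (G \<restriction> (C \<union> T))"
    unfolding P_def by blast
  have "C = A"
  proof (rule ccontr)
    assume "C \<noteq> A"
    \<comment> \<open>\<open>D\<close> is \<open>C\<close> with all its neighbours in
      \<open>B\<close>, so an arc leaving \<open>D\<close> cannot start in \<open>C\<close>. It
      starts at some \<open>u\<close> in \<open>B\<close> next to \<open>C\<close> and ends at a new
      \<open>v\<close> in \<open>A\<close>; adding both contradicts maximality.\<close>
    define D where "D = C \<union> {s \<in> B. \<exists>c\<in>C. c \<rightarrow>\<^bsub>G\<^esub> s}"
    have "D \<noteq> {}" "D \<subset> A \<union> B" using T \<open>C \<noteq> A\<close> disj unfolding D_def by auto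
    with conn obtain u v where uv: "u \<in> D" "v \<in> A \<union> B - D" "u \<rightarrow>\<^bsub>G\<^esub> v"
      unfolding connected_induce_subgraph_iff_cut[OF sub] by blast
    have "u \<notin> C" using uv T(1) indA unfolding D_def by blast
    then obtain c where c: "u \<in> B" "c \<in> C" "c \<rightarrow>\<^bsub>G\<^esub> u" using uv(1) unfolding D_def by blast
    have v: "v \<in> A" "v \<notin> C" using uv c indB unfolding D_def by blast+
    have CT: "C \<union> T \<subseteq> verts G" using T sub by blast
    have 1: "connected (G \<restriction> insert u (C \<union> T))"
      using connected_induce_subgraph_insert[OF CT T(6), of c u] c by blast
    have "insert u (C \<union> T) \<subseteq> verts G" using CT c sub by blast
    from connected_induce_subgraph_insert[OF this 1, of u v] uv(3)
    have "connected (G \<restriction> (insert v C \<union> insert u T))"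
      by (simp add: insert_commute)
    moreover have card: "card (insert v C) = Suc (card C)"
      using v T(1) fin finite_subset by (metis card_insert_disjoint)
    \<comment> \<open>\<open>u\<close> may already belong to \<open>T\<close>; either way
      \<open>T\<close> grows by at most one while \<open>C\<close> grows by exactly one.\<close>
    moreover have "card (insert u T) < Suc (card C)"
      using T(4,5) by (simp add: card_insert_if)
    ultimately have "P (insert v C)"
      unfolding P_def using v T c
      by (intro conjI exI[of _ "insert u T"]) auto
    from max[OF this] card show False by simp
  qed
  with T that show thesis by blast
qed

lemma (in wf_digraph) arcs_induce_subgraph_empty_iff:
  "arcs (G \<restriction> X) = {} \<longleftrightarrow> (\<forall>u\<in>X. \<forall>v\<in>X. \<not> u \<rightarrow>\<^bsub>G\<^esub> v)"
  unfolding arcs_ends_conv by auto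

theorem lemma14:
  fixes G :: "('a, 'b) pre_digraph" and I O' S :: "'a set"
  assumes "graph G"
    and "I \<subseteq> verts G" and "O' \<subseteq> verts G" and "I \<inter> O' = {}"
    and "I \<noteq> {}"
    and "arcs (G \<restriction> (I \<union> O')) = {}"
    and "arcs (G \<restriction> (verts G - (I \<union> O'))) = {}"
    and "minimal_IO_extension G I O' S"
  shows "card S \<le> card (I \<union> O')"
proof -
  interpret graph G by fact
  have indA: "\<not> u \<rightarrow>\<^bsub>G\<^esub> v" if "u \<in> I \<union> O'" "v \<in> I \<union> O'" for u v
    using assms(6) that unfolding arcs_induce_subgraph_empty_iff by blast
  have indB: "\<not> u \<rightarrow>\<^bsub>G\<^esub> v" if "u \<in> verts G - (I \<union> O')" "v \<in> verts G - (I \<union> O')" for u v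
    using assms(7) that unfolding arcs_induce_subgraph_empty_iff by blast
  have fin: "finite I" "finite O'"
    using assms(2,3) finite_verts finite_subset by blast+
  from assms(8) have S: "S \<subseteq> verts G" "S \<inter> (I \<union> O') = {}"
    and dom: "\<And>v. v \<in> verts G \<Longrightarrow> v \<notin> I \<union> S \<Longrightarrow> \<exists>x\<in>I \<union> S. v \<rightarrow>\<^bsub>G\<^esub> x"
    and conn: "connected (G \<restriction> (I \<union> S))"
    and min: "\<And>T. T \<subseteq> S \<Longrightarrow> IO_extension G I O' T \<Longrightarrow> T = S"
    unfolding minimal_IO_extension_def IO_extension_def connected_dominating_set_def by blast+
  have IS: "I \<union> S \<subseteq> verts G" using assms(2) S by blast
  \<comment> \<open>Since \<open>I\<close> is nonempty, \<open>{s}\<close> is a proper cut of the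
    connected set \<open>I \<union> S\<close>. The arc leaving it cannot end in \<open>S\<close>,
    which is independent.\<close>
  have S_adj: "\<exists>x\<in>I. s \<rightarrow>\<^bsub>G\<^esub> x" if "s \<in> S" for s
  proof -
    have "{s} \<noteq> {}" "{s} \<subset> I \<union> S" using that S assms(5) by auto
    with conn obtain x where "x \<in> I \<union> S" "s \<rightarrow>\<^bsub>G\<^esub> x"
      unfolding connected_induce_subgraph_iff_cut[OF IS] by blast
    then show ?thesis using indB that S by blast
  qed
  have "\<not> u \<rightarrow>\<^bsub>G\<^esub> v" if "u \<in> I" "v \<in> I" for u v using indA that by blast
  moreover have "\<not> u \<rightarrow>\<^bsub>G\<^esub> v" if "u \<in> S" "v \<in> S" for u v using indB that S by blast
  moreover have "I \<inter> S = {}" using S by blast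
  ultimately obtain T where T: "T \<subseteq> S" "finite T" "card T < card I" "connected (G \<restriction> (I \<union> T))"
    using bipartite_connector[OF fin(1) assms(5) IS conn] by metis
  \<comment> \<open>A dominator of a vertex of \<open>O'\<close> cannot lie in \<open>I\<close>,
    because \<open>I \<union> O'\<close> is independent.\<close>
  have "\<forall>v\<in>O'. \<exists>x\<in>S. v \<rightarrow>\<^bsub>G\<^esub> x" using dom assms(3,4) S indA by blast
  then obtain f where f: "\<And>v. v \<in> O' \<Longrightarrow> f v \<in> S \<and> v \<rightarrow>\<^bsub>G\<^esub> f v" by metis
  let ?R = "T \<union> f ` O'"
  have R: "?R \<subseteq> S" using T f by blast
  have "IO_extension G I O' ?R"
    unfolding IO_extension_def connected_dominating_set_def
  proof (intro conjI ballI)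
    show "?R \<subseteq> verts G" "?R \<inter> (I \<union> O') = {}" "I \<union> ?R \<subseteq> verts G" using R S IS by blast+
    \<comment> \<open>The chosen neighbours lie in \<open>S\<close>, so each of them attaches to
      \<open>I\<close> by \<open>S_adj\<close>.\<close>
    have "connected (G \<restriction> (I \<union> T \<union> f ` O'))"
      by (rule connected_induce_subgraph_Un)
        (use fin T IS f S_adj dominates_sym in blast)+
    then show "connected (G \<restriction> (I \<union> ?R))" by (simp add: Un_assoc)
    fix v assume v: "v \<in> verts G - (I \<union> ?R)"
    \<comment> \<open>Vertices of \<open>O'\<close> are dominated through \<open>f\<close>,
      discarded vertices of \<open>S\<close> by \<open>I\<close>. A vertex outside all three sets
      has a dominator in \<open>I \<union> S\<close>, which must lie in \<open>I\<close> since the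
      vertices outside \<open>I \<union> O'\<close> are independent.\<close>
    consider "v \<in> O'" | "v \<in> S" | "v \<notin> I \<union> O' \<union> S" using v by blast
    then show "\<exists>x\<in>I \<union> ?R. v \<rightarrow>\<^bsub>G\<^esub> x"
    proof cases
      case 1
      then show ?thesis using f by blast
    next
      case 2
      then show ?thesis using S_adj by blast
    next
      case 3
      then obtain x where "x \<in> I \<union> S" "v \<rightarrow>\<^bsub>G\<^esub> x" using dom v by blast
      then show ?thesis using indB[of v x] 3 v S by blast
    qed
  qed
  \<comment> \<open>Minimality forces \<open>?R\<close> to be the whole of \<open>S\<close>.\<close>
  then have "card S = card ?R" using min[OF R] by simp
  also have "\<dots> \<le> card T + card (f ` O')" by (rule card_Un_le)
  also have "\<dots> \<le> card I + card O'"
    using T(3) card_image_le[OF fin(2), of f] by simp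
  also have "\<dots> = card (I \<union> O')" using fin assms(4) by (simp add: card_Un_disjoint)
  finally show ?thesis .
qed

end
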